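(* Let $S$ and $S'$ be two $m$-optimal sets of binary strings. Then there exists a computable bijection $h$ on binary strings with $h(S)=S'$ (i.e. $x\in S\Leftrightarrow h(x)\in S'$) such that both $h$ and $h^{-1}$ are length-bounded (so $|h(x)|=|x|+O(1)$).
   Context: A total function $h$ on binary strings is length-bounded if $|h(x)|\le|x|+c$ for some $c$ and all $x$. An enumerable set $S$ is $m$-optimal if for every enumerable set $W$ there is a length-bounded total computable $h$ with $x\in W\Leftrightarrow h(x)\in S$ for all $x$. *)

theory Defs
  imports Main
begin

datatype recf = Zero | Succ | Proj nat | Comp recf "recf list" | Prim recf recf | Mu recf

text \<open>Graph of the partial function computed by a recursive-function term,
  applied to an argument list. Extra arguments are simply ignored.\<close>
inductive eval :: "recf \<Rightarrow> nat list \<Rightarrow> nat \<Rightarrow> bool" where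
  zero: "eval Zero xs 0"
| succ: "eval Succ (x # xs) (Suc x)"
| proj: "i < length xs \<Longrightarrow> eval (Proj i) xs (xs ! i)"
| comp: "list_all2 (\<lambda>g y. eval g xs y) gs ys \<Longrightarrow> eval f ys z \<Longrightarrow> eval (Comp f gs) xs z"
| prim0: "eval f xs z \<Longrightarrow> eval (Prim f g) (0 # xs) z"
| primS: "eval (Prim f g) (n # xs) r \<Longrightarrow> eval g (r # n # xs) z \<Longrightarrow> eval (Prim f g) (Suc n # xs) z"
| mu: "eval f (n # xs) 0 \<Longrightarrow> (\<forall>k<n. \<exists>v. eval f (k # xs) v \<and> 0 < v) \<Longrightarrow> eval (Mu f) xs n"

text \<open>Bijective coding of binary strings by natural numbers
  (empty string \<mapsto> 0, bijective base-2 numeration).\<close>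
fun enc :: "bool list \<Rightarrow> nat" where
  "enc [] = 0"
| "enc (b # bs) = 2 * enc bs + (if b then 2 else 1)"

definition computable :: "(bool list \<Rightarrow> bool list) \<Rightarrow> bool" where
  "computable h \<longleftrightarrow> (\<exists>f. \<forall>x. eval f [enc x] (enc (h x)))"

definition enumerable :: "bool list set \<Rightarrow> bool" where
  "enumerable W \<longleftrightarrow> (\<exists>f. \<forall>x. x \<in> W \<longleftrightarrow> (\<exists>v. eval f [enc x] v))"

definition length_bounded :: "(bool list \<Rightarrow> bool list) \<Rightarrow> bool" where
  "length_bounded h \<longleftrightarrow> (\<exists>c. \<forall>x. length (h x) \<le> length x + c)"

definition m_optimal :: "bool list set \<Rightarrow> bool" where
  "m_optimal S \<longleftrightarrow> enumerable S \<and>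
     (\<forall>W. enumerable W \<longrightarrow>
        (\<exists>h. computable h \<and> length_bounded h \<and> (\<forall>x. x \<in> W \<longleftrightarrow> h x \<in> S)))"

end

theory Submission
  imports Defs "HOL-Library.Nat_Bijection"
begin

text \<open>
  If each of the two sets reduces to the other by a computable injection \<open>F\<close> with
  \<open>x < F x \<le> C (x + 1)\<close> (strings being identified with numbers), then the
  Cantor-Bernstein bijection is itself computable, because tracing a point back along the two
  injections decreases it and hence stops; and it changes lengths by a bounded amount in both
  directions, because both injections do.

  Such injections come from a diagonal argument. Let \<open>W\<close> be the enumerable set of inputs
  \<open>2^e (2i + 1)\<close> treated as follows. Write \<open>h i\<close> for the output on that input of the
  function with code \<open>e\<close>. If \<open>h j = h i\<close> for some \<open>j < i\<close>, leave the input
  out. Otherwise put it in if \<open>h j = h i\<close> for some \<open>j > i\<close>, or if the number of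
  \<open>j < i\<close> with \<open>j < 4 (h j)\<close> is \<open>4x\<close> for some \<open>x\<close> in the source
  set. If \<open>e\<close> is a code of a reduction of \<open>W\<close> to the target set, a collision of
  \<open>h\<close> would send a member and a non-member of \<open>W\<close> to the same point. So \<open>h\<close>
  is injective, the indices \<open>i\<close> with \<open>i < 4 (h i)\<close> have positive density, and sending
  \<open>x\<close> to \<open>h i\<close> for the \<open>4x\<close>-th of them gives the required injection.
  The diagonal set needs a universal function, obtained by coding evaluation as derivability from
  finitely many Horn clauses.
\<close>

section \<open>Recursive functions\<close>

inductive_cases eval_ZeroE: "eval Zero xs y"
inductive_cases eval_SuccE: "eval Succ xs y"
inductive_cases eval_ProjE: "eval (Proj i) xs y"
inductive_cases eval_CompE: "eval (Comp f gs) xs y"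
inductive_cases eval_Prim0E: "eval (Prim f g) (0 # xs) y"
inductive_cases eval_PrimSE: "eval (Prim f g) (Suc n # xs) y"
inductive_cases eval_MuE: "eval (Mu f) xs y"

text \<open>Induction on the first evaluation. For \<open>Mu\<close>, the smaller of two different
  results would be a point where the body takes both 0 and a positive value.\<close>

lemma eval_deterministic: "eval f xs y \<Longrightarrow> eval f xs z \<Longrightarrow> y = z"
proof (induction arbitrary: z rule: eval.induct)
  case (comp xs gs ys f v)
  from comp.prems obtain ys' where 1: "list_all2 (\<lambda>g y. eval g xs y) gs ys'" "eval f ys' z"
    by (blast elim: eval_CompE)
  have "list_all2 (\<lambda>g y. \<forall>z. eval g xs z \<longrightarrow> y = z) gs ys"
    using comp.IH(1) by (rule list_all2_mono) auto
  with 1(1) have "ys = ys'"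
    by (auto simp: list_all2_conv_all_nth intro!: nth_equalityI)
  with 1 comp.IH(2) show ?case by blast
next
  case (primS f g n xs r v)
  from primS.prems show ?case using primS.IH by (blast elim: eval_PrimSE)
next
  case (mu f n xs)
  from mu.prems have z: "eval f (z # xs) 0" "\<forall>k<z. \<exists>v. eval f (k # xs) v \<and> 0 < v"
    by (blast elim: eval_MuE)+
  show ?case
  proof (rule linorder_cases[of n z])
    assume "n < z"
    with z(2) mu.IH(1) show ?thesis by fastforce
  next
    assume "z < n"
    with mu.IH(2) z(1) show ?thesis by (metis less_irrefl)
  qed
qed (blast elim: eval_ZeroE eval_SuccE eval_ProjE eval_Prim0E)+

lemma eval_Comp1: "eval g xs y \<Longrightarrow> eval f [y] z \<Longrightarrow> eval (Comp f [g]) xs z"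
  by (rule eval.comp[where ys = "[y]"]) auto

lemma eval_Comp2:
  "eval g xs y \<Longrightarrow> eval g' xs y' \<Longrightarrow> eval f [y, y'] z \<Longrightarrow> eval (Comp f [g, g']) xs z"
  by (rule eval.comp[where ys = "[y, y']"]) auto

lemma eval_Proj0: "eval (Proj 0) (x # xs) x"
  using eval.proj[of 0 "x # xs"] by simp

lemma eval_Proj1: "eval (Proj 1) (x # y # xs) y"
  using eval.proj[of 1 "x # y # xs"] by simp

lemma eval_Proj2: "eval (Proj 2) (x # y # z # xs) z"
  using eval.proj[of 2 "x # y # z # xs"] by simp

section \<open>Closure properties of total recursive functions\<close>

definition recursive :: "(nat \<Rightarrow> nat) \<Rightarrow> bool" where
  "recursive F \<longleftrightarrow> (\<exists>f. \<forall>x. eval f [x] (F x))"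

definition recursive2 :: "(nat \<Rightarrow> nat \<Rightarrow> nat) \<Rightarrow> bool" where
  "recursive2 F \<longleftrightarrow> (\<exists>f. \<forall>x y. eval f [x, y] (F x y))"

named_theorems recursive_intros

lemma recursiveI: "(\<And>x. eval f [x] (F x)) \<Longrightarrow> recursive F"
  unfolding recursive_def by blast

lemma recursiveE:
  assumes "recursive F"
  obtains f where "\<And>x. eval f [x] (F x)"
  using assms unfolding recursive_def by blast

lemma recursive2I: "(\<And>x y. eval f [x, y] (F x y)) \<Longrightarrow> recursive2 F"
  unfolding recursive2_def by blast

lemma recursive2E:
  assumes "recursive2 F"
  obtains f where "\<And>x y. eval f [x, y] (F x y)"
  using assms unfolding recursive2_def by blast

lemma recursive_id [recursive_intros]: "recursive (\<lambda>x. x)"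
  by (rule recursiveI) (rule eval_Proj0)

lemma recursive_comp:
  assumes "recursive F" and "recursive A"
  shows "recursive (\<lambda>x. F (A x))"
proof -
  obtain f a where f: "\<And>x. eval f [x] (F x)" and a: "\<And>x. eval a [x] (A x)"
    using assms unfolding recursive_def by auto
  show ?thesis by (rule recursiveI) (rule eval_Comp1[OF a f])
qed

lemma recursive2_comp:
  assumes "recursive2 F" and "recursive A" and "recursive B"
  shows "recursive (\<lambda>x. F (A x) (B x))"
proof -
  obtain f a b where f: "\<And>x y. eval f [x, y] (F x y)"
    and a: "\<And>x. eval a [x] (A x)" and b: "\<And>x. eval b [x] (B x)"
    using assms by (metis recursiveE recursive2E)
  show ?thesis by (rule recursiveI) (rule eval_Comp2[OF a b f])
qed

lemma recursive_Suc [recursive_intros]: "recursive A \<Longrightarrow> recursive (\<lambda>x. Suc (A x))"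
  by (rule recursive_comp[of Suc]) (rule recursiveI, rule eval.succ)

lemma recursive_const [recursive_intros]: "recursive (\<lambda>x. c)"
proof (induction c)
  case 0
  show ?case by (rule recursiveI) (rule eval.zero)
next
  case (Suc c)
  then show ?case by (rule recursive_Suc)
qed

lemma eval_add: "eval (Prim (Proj 0) (Comp Succ [Proj 0])) [n, x] (n + x)"
proof (induction n)
  case 0
  show ?case using eval.prim0[OF eval_Proj0] by simp
next
  case (Suc n)
  show ?case using eval.primS[OF Suc.IH eval_Comp1[OF eval_Proj0 eval.succ]] by simp
qed

lemma recursive_add [recursive_intros]:
  "recursive A \<Longrightarrow> recursive B \<Longrightarrow> recursive (\<lambda>x. A x + B x)"
  by (rule recursive2_comp) (rule recursive2I, rule eval_add)

lemma eval_mult: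
  "eval (Prim Zero (Comp (Prim (Proj 0) (Comp Succ [Proj 0])) [Proj 2, Proj 0])) [n, x] (n * x)"
proof (induction n)
  case 0
  show ?case using eval.prim0[OF eval.zero] by simp
next
  case (Suc n)
  show ?case
    using eval.primS[OF Suc.IH eval_Comp2[OF eval_Proj2 eval_Proj0 eval_add]] by simp
qed

lemma recursive_mult [recursive_intros]:
  "recursive A \<Longrightarrow> recursive B \<Longrightarrow> recursive (\<lambda>x. A x * B x)"
  by (rule recursive2_comp) (rule recursive2I, rule eval_mult)

lemma eval_pred: "eval (Prim Zero (Proj 1)) [n] (n - 1)"
proof (induction n)
  case (Suc n)
  then show ?case using eval.primS[OF Suc.IH eval_Proj1] by simp
qed (simp add: eval.prim0 eval.zero)

text \<open>\<open>Prim\<close> recurses on its first argument, so the subtrahend comes first;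
  \<open>recursive_minus\<close> swaps the two back.\<close>

lemma eval_minus:
  "eval (Prim (Proj 0) (Comp (Prim Zero (Proj 1)) [Proj 0])) [n, x] (x - n)"
proof (induction n)
  case (Suc n)
  have "x - Suc n = x - n - 1" by simp
  then show ?case
    using eval.primS[OF Suc.IH eval_Comp1[OF eval_Proj0 eval_pred]] by simp
qed (simp add: eval.prim0 eval_Proj0)

lemma recursive_minus [recursive_intros]:
  "recursive A \<Longrightarrow> recursive B \<Longrightarrow> recursive (\<lambda>x. A x - B x)"
  by (rule recursive2_comp[where F = "\<lambda>n x. x - n"])
    (rule recursive2I, rule eval_minus)

lemma recursive_triangle [recursive_intros]:
  assumes "recursive A"
  shows "recursive (\<lambda>x. triangle (A x))"
proof (rule recursive_comp[OF _ assms])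
  have "eval (Prim Zero (Comp Succ [Comp (Prim (Proj 0) (Comp Succ [Proj 0])) [Proj 0, Proj 1]]))
      [n] (triangle n)" for n
  proof (induction n)
    case (Suc n)
    then show ?case
      using eval.primS[OF Suc.IH eval_Comp1[OF eval_Comp2[OF eval_Proj0 eval_Proj1 eval_add] eval.succ]]
      by simp
  qed (simp add: eval.prim0 eval.zero)
  then show "recursive triangle" by (rule recursiveI)
qed

lemma recursive_pair [recursive_intros]:
  "recursive A \<Longrightarrow> recursive B \<Longrightarrow> recursive (\<lambda>x. prod_encode (A x, B x))"
  unfolding prod_encode_def prod.case by (intro recursive_intros)

lemma recursive2_pair: "recursive2 (\<lambda>a b. prod_encode (a, b))"
proof -
  define ad where "ad = Prim (Proj 0) (Comp Succ [Proj 0])"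
  obtain tr where tr: "\<And>n. eval tr [n] (triangle n)"
    using recursive_triangle[OF recursive_id] by (metis recursiveE)
  have "eval (Comp ad [Comp tr [ad], Proj 0]) [a, b] (triangle (a + b) + a)" for a b
    unfolding ad_def by (rule eval_Comp2[OF eval_Comp1[OF eval_add tr] eval_Proj0 eval_add])
  then show ?thesis unfolding prod_encode_def prod.case by (rule recursive2I)
qed

lemma eval_Mu_Least:
  assumes "\<And>n. eval f (n # xs) (D n)" and "D m = 0"
  shows "eval (Mu f) xs (LEAST n. D n = 0)"
proof (rule eval.mu)
  have "D (LEAST n. D n = 0) = 0" by (rule LeastI) (fact assms(2))
  then show "eval f ((LEAST n. D n = 0) # xs) 0" using assms(1)[of "LEAST n. D n = 0"] by simp
  show "\<forall>k<LEAST n. D n = 0. \<exists>v. eval f (k # xs) v \<and> 0 < v"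
  proof (intro allI impI)
    fix k assume "k < (LEAST n. D n = 0)"
    then have "D k \<noteq> 0" by (rule not_less_Least)
    then show "\<exists>v. eval f (k # xs) v \<and> 0 < v" using assms(1)[of k] by blast
  qed
qed

text \<open>The closure rules are stated for unary functions; packing two arguments into one number
  makes them available for binary ones.\<close>

lemma recursive2_decodeI:
  assumes "recursive (\<lambda>z. F (fst (prod_decode z)) (snd (prod_decode z)))"
  shows "recursive2 F"
proof -
  obtain f where f: "\<And>z. eval f [z] (F (fst (prod_decode z)) (snd (prod_decode z)))"
    using assms unfolding recursive_def by auto
  obtain p where p: "\<And>a b. eval p [a, b] (prod_encode (a, b))"
    using recursive2_pair by (metis recursive2E)
  have "eval (Comp f [p]) [a, b] (F a b)" for a b
    using eval_Comp1[OF p f, of a b] by simp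
  then show ?thesis by (rule recursive2I)
qed

lemma recursive_Least:
  assumes "recursive2 D" and "\<And>x. \<exists>n. D n x = 0"
  shows "recursive (\<lambda>x. LEAST n. D n x = 0)"
proof -
  obtain f where f: "\<And>n x. eval f [n, x] (D n x)"
    using assms(1) unfolding recursive2_def by auto
  have "eval (Mu f) [x] (LEAST n. D n x = 0)" for x
  proof -
    obtain m where "D m x = 0" using assms(2) by blast
    then show ?thesis using eval_Mu_Least[of f "[x]" "\<lambda>n. D n x"] f by simp
  qed
  then show ?thesis by (rule recursiveI)
qed

section \<open>Inversion of the Cantor pairing\<close>

lemma strict_mono_triangle: "strict_mono triangle"
  by (auto simp: strict_mono_Suc_iff)

text \<open>The diagonal on which \<open>z\<close> lies is the least \<open>s\<close> with
  \<open>z < triangle (Suc s)\<close>, found by minimisation. Subtractions then give both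
  components.\<close>

lemma recursive_pair_sum: "recursive (\<lambda>z. fst (prod_decode z) + snd (prod_decode z))"
proof -
  have *: "(LEAST s. Suc z - triangle (Suc s) = 0) = fst (prod_decode z) + snd (prod_decode z)" for z
  proof -
    obtain a b where ab: "prod_decode z = (a, b)" by force
    then have z: "z = triangle (a + b) + a"
      using prod_decode_inverse[of z] by (simp add: prod_encode_def)
    have "(LEAST s. Suc z - triangle (Suc s) = 0) = a + b"
    proof (rule Least_equality)
      fix s assume "Suc z - triangle (Suc s) = 0"
      then have "triangle (a + b) < triangle (Suc s)" using z by simp
      then show "a + b \<le> s" by (simp only: strict_mono_less[OF strict_mono_triangle] less_Suc_eq_le)
    qed (simp add: z)
    then show ?thesis by (simp add: ab)
  qed
  obtain tr where tr: "\<And>n. eval tr [n] (triangle n)"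
    using recursive_triangle[OF recursive_id] by (metis recursiveE)
  have "eval (Comp (Prim (Proj 0) (Comp (Prim Zero (Proj 1)) [Proj 0]))
      [Comp tr [Comp Succ [Proj 0]], Comp Succ [Proj 1]]) [s, z] (Suc z - triangle (Suc s))" for s z
    by (rule eval_Comp2[OF eval_Comp1[OF eval_Comp1[OF eval_Proj0 eval.succ] tr]
        eval_Comp1[OF eval_Proj1 eval.succ] eval_minus])
  then have "recursive2 (\<lambda>s z. Suc z - triangle (Suc s))" by (rule recursive2I)
  moreover have "\<exists>s. Suc z - triangle (Suc s) = 0" for z
    by (rule exI[of _ z]) simp
  ultimately have "recursive (\<lambda>z. LEAST s. Suc z - triangle (Suc s) = 0)"
    by (rule recursive_Least)
  then show ?thesis unfolding * .
qed

lemma recursive_fst [recursive_intros]: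
  assumes "recursive A"
  shows "recursive (\<lambda>x. fst (prod_decode (A x)))"
proof (rule recursive_comp[OF _ assms])
  have "fst p = prod_encode p - triangle (fst p + snd p)" for p
    by (simp add: prod_encode_def case_prod_unfold)
  from this[of "prod_decode _"]
  have *: "(\<lambda>z. fst (prod_decode z)) =
      (\<lambda>z. z - triangle (fst (prod_decode z) + snd (prod_decode z)))"
    unfolding prod_decode_inverse by (rule ext)
  show "recursive (\<lambda>z. fst (prod_decode z))"
    by (subst *) (intro recursive_intros recursive_pair_sum)
qed

lemma recursive_snd [recursive_intros]:
  assumes "recursive A"
  shows "recursive (\<lambda>x. snd (prod_decode (A x)))"
proof -
  have "recursive (\<lambda>z. fst (prod_decode z) + snd (prod_decode z) - fst (prod_decode z))"
    by (intro recursive_intros recursive_pair_sum)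
  then show ?thesis using recursive_comp[OF _ assms, of "\<lambda>z. snd (prod_decode z)"] by simp
qed

section \<open>Primitive recursion and coded sequences\<close>

lemma recursive_rec_nat:
  assumes "recursive A" and "recursive G"
    and "\<And>x. F 0 x = A x" and "\<And>n x. F (Suc n) x = G (prod_encode (F n x, prod_encode (n, x)))"
    and "recursive B" and "recursive C"
  shows "recursive (\<lambda>x. F (B x) (C x))"
proof (rule recursive2_comp[OF _ assms(5,6)])
  obtain a g where a: "\<And>x. eval a [x] (A x)" and g: "\<And>x. eval g [x] (G x)"
    using assms(1,2) unfolding recursive_def by auto
  obtain p where p: "\<And>a b. eval p [a, b] (prod_encode (a, b))"
    using recursive2_pair by (metis recursive2E)
  have "eval (Prim a (Comp g [Comp p [Proj 0, Comp p [Proj 1, Proj 2]]])) [n, x] (F n x)" for n x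
  proof (induction n)
    case (Suc n)
    show ?case
      unfolding assms(4)
      by (rule eval.primS[OF Suc.IH
            eval_Comp1[OF eval_Comp2[OF eval_Proj0 eval_Comp2[OF eval_Proj1 eval_Proj2 p] p] g]])
  qed (simp add: eval.prim0 a assms(3))
  then show "recursive2 F" by (rule recursive2I)
qed

text \<open>Sums and products will stand in for bounded quantifiers: a sum vanishes when all terms
  do, a product when some factor does.\<close>

lemma recursive_sum:
  assumes A: "recursive (\<lambda>z. A (fst (prod_decode z)) (snd (prod_decode z)))" and "recursive B"
  shows "recursive (\<lambda>x. \<Sum>i<B x. A i x)"
proof (rule recursive_rec_nat[where F = "\<lambda>n x. \<Sum>i<n. A i x" and A = "\<lambda>x. 0" and
      G = "\<lambda>z. fst (prod_decode z) + A (fst (prod_decode (snd (prod_decode z))))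
        (snd (prod_decode (snd (prod_decode z))))"])
  show "recursive (\<lambda>z. fst (prod_decode z) + A (fst (prod_decode (snd (prod_decode z))))
        (snd (prod_decode (snd (prod_decode z)))))"
    by (intro recursive_intros recursive_comp[OF A])
qed (auto intro: recursive_intros assms(2))

lemma recursive_prod:
  assumes A: "recursive (\<lambda>z. A (fst (prod_decode z)) (snd (prod_decode z)))" and "recursive B"
  shows "recursive (\<lambda>x. \<Prod>i<B x. A i x)"
proof (rule recursive_rec_nat[where F = "\<lambda>n x. \<Prod>i<n. A i x" and A = "\<lambda>x. 1" and
      G = "\<lambda>z. fst (prod_decode z) * A (fst (prod_decode (snd (prod_decode z))))
        (snd (prod_decode (snd (prod_decode z))))"])
  show "recursive (\<lambda>z. fst (prod_decode z) * A (fst (prod_decode (snd (prod_decode z))))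
        (snd (prod_decode (snd (prod_decode z)))))"
    by (intro recursive_intros recursive_comp[OF A])
qed (auto intro: recursive_intros assms(2))

lemma recursive_power2 [recursive_intros]:
  assumes "recursive B"
  shows "recursive (\<lambda>x. 2 ^ B x)"
  by (rule recursive_rec_nat[where F = "\<lambda>n x. 2 ^ n" and A = "\<lambda>x. 1" and C = "\<lambda>x. x" and
      G = "\<lambda>z. 2 * fst (prod_decode z)"])
    (auto intro!: recursive_intros assms)

text \<open>Every number codes an infinite sequence, almost all of whose entries are irrelevant; this makes
  finite sequences available without a length.\<close>

definition entry :: "nat \<Rightarrow> nat \<Rightarrow> nat" where
  "entry L i = fst (prod_decode (((\<lambda>z. snd (prod_decode z)) ^^ i) L))"

lemma recursive_entry [recursive_intros]:
  assumes "recursive A" and "recursive B"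
  shows "recursive (\<lambda>x. entry (A x) (B x))"
  unfolding entry_def
  by (intro recursive_fst recursive_rec_nat[where F = "\<lambda>i L. ((\<lambda>z. snd (prod_decode z)) ^^ i) L" and
      A = "\<lambda>x. x" and G = "\<lambda>z. snd (prod_decode (fst (prod_decode z)))"])
    (auto intro!: recursive_intros assms)

text \<open>The head of the pair takes \<open>f 0\<close> and the tail codes the shifted sequence;
  hence \<open>f\<close> is generalised.\<close>

lemma ex_entry: "\<exists>L. \<forall>i<n. entry L i = f i"
proof (induction n arbitrary: f)
  case (Suc n)
  obtain L where L: "\<forall>i<n. entry L i = f (Suc i)" using Suc.IH[of "\<lambda>i. f (Suc i)"] by blast
  have "entry (prod_encode (f 0, L)) i = f i" if "i < Suc n" for i
    using L that by (cases i) (simp_all add: entry_def funpow_Suc_right del: funpow.simps(2))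
  then show ?case by blast
qed simp

section \<open>Semirecursive predicates\<close>

text \<open>Here \<open>n\<close> is a witness and \<open>D\<close> a total test that accepts with
  value 0. Totality turns closure under connectives into arithmetic on such tests.\<close>

definition semirec :: "(nat \<Rightarrow> bool) \<Rightarrow> bool" where
  "semirec P \<longleftrightarrow> (\<exists>D. recursive2 D \<and> (\<forall>x. P x \<longleftrightarrow> (\<exists>n. D n x = 0)))"

lemma semirecI:
  assumes "recursive (\<lambda>z. D (fst (prod_decode z)) (snd (prod_decode z)))"
    and "\<And>x. P x \<longleftrightarrow> (\<exists>n. D n x = 0)"
  shows "semirec P"
  unfolding semirec_def using recursive2_decodeI[of D, OF assms(1)] assms(2) by blast

lemma semirec_cong: "(\<And>x. P x \<longleftrightarrow> Q x) \<Longrightarrow> semirec P \<longleftrightarrow> semirec Q"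
  unfolding semirec_def by simp

lemma ex_prod_decode_iff:
  "(\<exists>n. Q (fst (prod_decode n)) (snd (prod_decode n))) \<longleftrightarrow> (\<exists>a b. Q a b)"
proof
  assume "\<exists>a b. Q a b"
  then obtain a b where "Q a b" by blast
  then show "\<exists>n. Q (fst (prod_decode n)) (snd (prod_decode n))"
    by (intro exI[of _ "prod_encode (a, b)"]) simp
qed blast

lemma semirec_comp:
  assumes "semirec P" and "recursive A"
  shows "semirec (\<lambda>x. P (A x))"
proof -
  obtain D where D: "recursive2 D" and P: "\<And>x. P x \<longleftrightarrow> (\<exists>n. D n x = 0)"
    using assms(1) unfolding semirec_def by auto
  show ?thesis
    by (rule semirecI[where D = "\<lambda>n x. D n (A x)"])
      (intro recursive2_comp[OF D] recursive_intros recursive_comp[OF assms(2)], simp add: P)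
qed

lemma semirec_eq [recursive_intros]:
  assumes "recursive A" and "recursive B"
  shows "semirec (\<lambda>x. A x = B x)"
  by (rule semirecI[where D = "\<lambda>n x. (A x - B x) + (B x - A x)"])
    (intro recursive_intros recursive_comp[OF assms(1)] recursive_comp[OF assms(2)], auto)

lemma semirec_less [recursive_intros]:
  assumes "recursive A" and "recursive B"
  shows "semirec (\<lambda>x. A x < B x)"
  by (rule semirecI[where D = "\<lambda>n x. Suc (A x) - B x"])
    (intro recursive_intros recursive_comp[OF assms(1)] recursive_comp[OF assms(2)], auto)

lemma semirec_neq [recursive_intros]:
  assumes "recursive A" and "recursive B"
  shows "semirec (\<lambda>x. A x \<noteq> B x)"
  by (rule semirecI[where D = "\<lambda>n x. 1 - ((A x - B x) + (B x - A x))"])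
    (intro recursive_intros recursive_comp[OF assms(1)] recursive_comp[OF assms(2)], auto)

lemma semirec_conj [recursive_intros]:
  assumes "semirec P" and "semirec Q"
  shows "semirec (\<lambda>x. P x \<and> Q x)"
proof -
  obtain D where D: "recursive2 D" and P: "\<And>x. P x \<longleftrightarrow> (\<exists>n. D n x = 0)"
    using assms(1) unfolding semirec_def by auto
  obtain E where E: "recursive2 E" and Q: "\<And>x. Q x \<longleftrightarrow> (\<exists>n. E n x = 0)"
    using assms(2) unfolding semirec_def by auto
  show ?thesis
  proof (rule semirecI[where D = "\<lambda>n x. D (fst (prod_decode n)) x + E (snd (prod_decode n)) x"])
    show "(P x \<and> Q x) = (\<exists>n. D (fst (prod_decode n)) x + E (snd (prod_decode n)) x = 0)" for x
      unfolding P Q using ex_prod_decode_iff[of "\<lambda>a b. D a x + E b x = 0"] by simp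
  qed (intro recursive2_comp[OF D] recursive2_comp[OF E] recursive_intros)
qed

lemma semirec_disj [recursive_intros]:
  assumes "semirec P" and "semirec Q"
  shows "semirec (\<lambda>x. P x \<or> Q x)"
proof -
  obtain D where D: "recursive2 D" and P: "\<And>x. P x \<longleftrightarrow> (\<exists>n. D n x = 0)"
    using assms(1) unfolding semirec_def by auto
  obtain E where E: "recursive2 E" and Q: "\<And>x. Q x \<longleftrightarrow> (\<exists>n. E n x = 0)"
    using assms(2) unfolding semirec_def by auto
  show ?thesis
    by (rule semirecI[where D = "\<lambda>n x. D n x * E n x"])
      (intro recursive2_comp[OF D] recursive2_comp[OF E] recursive_intros, auto simp: P Q)
qed

lemma semirec_ex [recursive_intros]:
  assumes "semirec (\<lambda>z. P (fst (prod_decode z)) (snd (prod_decode z)))"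
  shows "semirec (\<lambda>x. \<exists>n. P n x)"
proof -
  obtain D where D: "recursive2 D"
    and P: "\<And>z. P (fst (prod_decode z)) (snd (prod_decode z)) \<longleftrightarrow> (\<exists>n. D n z = 0)"
    using assms unfolding semirec_def by auto
  have P': "P n x \<longleftrightarrow> (\<exists>m. D m (prod_encode (n, x)) = 0)" for n x
    using P[of "prod_encode (n, x)"] by simp
  show ?thesis
  proof (rule semirecI[where
        D = "\<lambda>n x. D (fst (prod_decode n)) (prod_encode (snd (prod_decode n), x))"])
    show "(\<exists>n. P n x) = (\<exists>n. D (fst (prod_decode n)) (prod_encode (snd (prod_decode n), x)) = 0)" for x
      unfolding P' using ex_prod_decode_iff[of "\<lambda>a b. D a (prod_encode (b, x)) = 0"] by blast
  qed (intro recursive2_comp[OF D] recursive_intros)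
qed

text \<open>Finitely many indices have witnesses below a common bound \<open>N\<close>. The sum of
  products is zero exactly when each \<open>i < B x\<close> has a witness below
  \<open>N\<close>.\<close>

lemma semirec_all_less [recursive_intros]:
  assumes "semirec (\<lambda>z. P (fst (prod_decode z)) (snd (prod_decode z)))" and B: "recursive B"
  shows "semirec (\<lambda>x. \<forall>i<B x. P i x)"
proof -
  obtain D where D: "recursive2 D"
    and P: "\<And>z. P (fst (prod_decode z)) (snd (prod_decode z)) \<longleftrightarrow> (\<exists>n. D n z = 0)"
    using assms(1) unfolding semirec_def by auto
  have P': "P i x \<longleftrightarrow> (\<exists>m. D m (prod_encode (i, x)) = 0)" for i x
    using P[of "prod_encode (i, x)"] by simp
  let ?D = "\<lambda>N x. \<Sum>i<B x. \<Prod>n<N. D n (prod_encode (i, x))"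
  show ?thesis
  proof (rule semirecI[where D = ?D])
    show "recursive (\<lambda>z. ?D (fst (prod_decode z)) (snd (prod_decode z)))"
      by (intro recursive_sum recursive_prod recursive2_comp[OF D] recursive_intros recursive_comp[OF B])
    show "(\<forall>i<B x. P i x) \<longleftrightarrow> (\<exists>N. ?D N x = 0)" for x
    proof
      assume "\<forall>i<B x. P i x"
      then obtain m where m: "\<And>i. i < B x \<Longrightarrow> D (m i) (prod_encode (i, x)) = 0"
        unfolding P' by metis
      have "m i < Suc (\<Sum>i<B x. m i)" if "i < B x" for i
        using member_le_sum[of i "{..<B x}" m] that by simp
      with m have "?D (Suc (\<Sum>i<B x. m i)) x = 0"
        by (simp only: sum_eq_0_iff prod_zero_iff finite_lessThan) auto
      then show "\<exists>N. ?D N x = 0" by (rule exI)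
    next
      assume "\<exists>N. ?D N x = 0"
      then show "\<forall>i<B x. P i x" unfolding P' by auto
    qed
  qed
qed

text \<open>Search for a pair of a witness and a value. Totality of \<open>F\<close> makes the
  search end, and any accepted value is the right one.\<close>

lemma recursive_graph:
  assumes "semirec (\<lambda>z. F (fst (prod_decode z)) = snd (prod_decode z))"
  shows "recursive F"
proof -
  obtain D where D: "recursive2 D"
    and F: "\<And>z. F (fst (prod_decode z)) = snd (prod_decode z) \<longleftrightarrow> (\<exists>n. D n z = 0)"
    using assms unfolding semirec_def by auto
  have F': "F x = y \<longleftrightarrow> (\<exists>n. D n (prod_encode (x, y)) = 0)" for x y
    using F[of "prod_encode (x, y)"] by simp
  let ?E = "\<lambda>n x. D (fst (prod_decode n)) (prod_encode (x, snd (prod_decode n)))"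
  have ex: "\<exists>n. ?E n x = 0" for x
    using F'[of x "F x"] ex_prod_decode_iff[of "\<lambda>a b. D a (prod_encode (x, b)) = 0"] by blast
  have "recursive (\<lambda>x. LEAST n. ?E n x = 0)"
    by (intro recursive_Least recursive2_decodeI recursive2_comp[OF D] recursive_intros ex)
  then have "recursive (\<lambda>x. snd (prod_decode (LEAST n. ?E n x = 0)))"
    by (rule recursive_snd)
  moreover have "F x = snd (prod_decode (LEAST n. ?E n x = 0))" for x
    unfolding F' using LeastI_ex[OF ex[of x]] by blast
  then have "F = (\<lambda>x. snd (prod_decode (LEAST n. ?E n x = 0)))" by (rule ext)
  ultimately show ?thesis by simp
qed

lemma semirec_domain:
  assumes "semirec P"
  shows "\<exists>f. \<forall>x. P x \<longleftrightarrow> (\<exists>v. eval f [x] v)"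
proof -
  obtain D where D: "recursive2 D" and P: "\<And>x. P x \<longleftrightarrow> (\<exists>n. D n x = 0)"
    using assms unfolding semirec_def by auto
  obtain f where f: "\<And>n x. eval f [n, x] (D n x)" using D unfolding recursive2_def by auto
  have "P x \<longleftrightarrow> (\<exists>v. eval (Mu f) [x] v)" for x
  proof
    assume "P x"
    then obtain n where "D n x = 0" unfolding P by blast
    then show "\<exists>v. eval (Mu f) [x] v"
      using eval_Mu_Least[of f "[x]" "\<lambda>n. D n x"] f by blast
  next
    assume "\<exists>v. eval (Mu f) [x] v"
    then obtain n where "eval f [n, x] 0" by (blast elim: eval_MuE)
    with f[of n x] have "D n x = 0" by (rule eval_deterministic)
    then show "P x" unfolding P by blast
  qed
  then show ?thesis by blast
qed

section \<open>Derivability from Horn clauses with two premises\<close>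

inductive derivable :: "(nat \<Rightarrow> bool) \<Rightarrow> (nat \<Rightarrow> nat \<Rightarrow> nat \<Rightarrow> bool) \<Rightarrow> nat \<Rightarrow> bool"
  for R0 R2 where
  base: "R0 t \<Longrightarrow> derivable R0 R2 t"
| step: "R2 t p q \<Longrightarrow> derivable R0 R2 p \<Longrightarrow> derivable R0 R2 q \<Longrightarrow> derivable R0 R2 t"

definition derivation :: "(nat \<Rightarrow> bool) \<Rightarrow> (nat \<Rightarrow> nat \<Rightarrow> nat \<Rightarrow> bool) \<Rightarrow> nat list \<Rightarrow> bool" where
  "derivation R0 R2 ts \<longleftrightarrow>
    (\<forall>i<length ts. R0 (ts ! i) \<or> (\<exists>j k. j < i \<and> k < i \<and> R2 (ts ! i) (ts ! j) (ts ! k)))"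

lemma derivation_append:
  assumes "derivation R0 R2 ts" and "derivation R0 R2 us"
  shows "derivation R0 R2 (ts @ us)"
  unfolding derivation_def
proof (intro allI impI)
  let ?vs = "ts @ us"
  fix i assume i: "i < length ?vs"
  show "R0 (?vs ! i) \<or> (\<exists>j k. j < i \<and> k < i \<and> R2 (?vs ! i) (?vs ! j) (?vs ! k))"
  proof (cases "i < length ts")
    case True
    with assms(1) consider "R0 (ts ! i)"
      | j k where "j < i" "k < i" "R2 (ts ! i) (ts ! j) (ts ! k)"
      unfolding derivation_def by blast
    then show ?thesis
    proof cases
      case 2
      with True show ?thesis by (intro disjI2 exI[of _ j] exI[of _ k]) (simp add: nth_append)
    qed (use True in \<open>simp add: nth_append\<close>)
  next
    case False
    then obtain m where m: "i = length ts + m" by (metis add_diff_inverse_nat)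
    with i have "m < length us" by simp
    with assms(2) consider "R0 (us ! m)"
      | j k where "j < m" "k < m" "R2 (us ! m) (us ! j) (us ! k)"
      unfolding derivation_def by blast
    then show ?thesis
    proof cases
      case 2
      then show ?thesis
        by (intro disjI2 exI[of _ "length ts + j"] exI[of _ "length ts + k"]) (simp add: m)
    qed (simp add: m)
  qed
qed

lemma derivation_snoc:
  assumes "derivation R0 R2 ts" and "R0 t \<or> (\<exists>p\<in>set ts. \<exists>q\<in>set ts. R2 t p q)"
  shows "derivation R0 R2 (ts @ [t])"
  unfolding derivation_def
proof (intro allI impI)
  let ?vs = "ts @ [t]"
  fix i assume i: "i < length ?vs"
  show "R0 (?vs ! i) \<or> (\<exists>j k. j < i \<and> k < i \<and> R2 (?vs ! i) (?vs ! j) (?vs ! k))"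
  proof (cases "i < length ts")
    case True
    with assms(1) consider "R0 (ts ! i)"
      | j k where "j < i" "k < i" "R2 (ts ! i) (ts ! j) (ts ! k)"
      unfolding derivation_def by blast
    then show ?thesis
    proof cases
      case 2
      with True show ?thesis by (intro disjI2 exI[of _ j] exI[of _ k]) (simp add: nth_append)
    qed (use True in \<open>simp add: nth_append\<close>)
  next
    case False
    with i have m: "i = length ts" by simp
    from assms(2) show ?thesis
    proof
      assume "\<exists>p\<in>set ts. \<exists>q\<in>set ts. R2 t p q"
      then obtain p q where "p \<in> set ts" "q \<in> set ts" "R2 t p q" by blast
      then obtain j k where "j < i" "k < i" "R2 t (ts ! j) (ts ! k)"
        unfolding m by (metis in_set_conv_nth)
      then show ?thesis by (intro disjI2 exI[of _ j] exI[of _ k]) (simp add: m nth_append)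
    qed (simp add: m)
  qed
qed

text \<open>A derivation tree is flattened by listing the derivations of both premises before the
  conclusion. Conversely, strong induction on the position shows every member of the list
  derivable.\<close>

lemma derivable_iff_derivation:
  "derivable R0 R2 t \<longleftrightarrow> (\<exists>ts. derivation R0 R2 (ts @ [t]))"
proof
  assume "derivable R0 R2 t"
  then show "\<exists>ts. derivation R0 R2 (ts @ [t])"
  proof induction
    case (base t)
    then have "derivation R0 R2 ([] @ [t])" by (intro derivation_snoc) (auto simp: derivation_def)
    then show ?case by blast
  next
    case (step t p q)
    then obtain us vs where "derivation R0 R2 (us @ [p])" and "derivation R0 R2 (vs @ [q])" by blast
    then have "derivation R0 R2 ((us @ [p]) @ (vs @ [q]))" by (rule derivation_append)
    then have "derivation R0 R2 (((us @ [p]) @ (vs @ [q])) @ [t])"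
      using step.hyps(1) by (intro derivation_snoc) auto
    then show ?case by blast
  qed
next
  assume "\<exists>ts. derivation R0 R2 (ts @ [t])"
  then obtain ts where ts: "derivation R0 R2 (ts @ [t])" by blast
  have "derivable R0 R2 ((ts @ [t]) ! i)" if "i < length (ts @ [t])" for i
    using that
  proof (induction i rule: less_induct)
    case (less i)
    with ts consider "R0 ((ts @ [t]) ! i)"
      | j k where "j < i" "k < i" "R2 ((ts @ [t]) ! i) ((ts @ [t]) ! j) ((ts @ [t]) ! k)"
      unfolding derivation_def by blast
    then show ?case
    proof cases
      case 1
      then show ?thesis by (rule derivable.base)
    next
      case 2
      with less show ?thesis by (meson derivable.step order.strict_trans)
    qed
  qed
  from this[of "length ts"] show "derivable R0 R2 t" by simp
qed

text \<open>A derivation is a finite list, hence coded by one number \<open>L\<close>, with its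
  conclusion at position \<open>n\<close>. Checking it is a bounded universal quantifier over
  semirecursive conditions.\<close>

lemma semirec_derivable:
  assumes R0: "semirec R0"
    and R2: "semirec (\<lambda>z. R2 (fst (prod_decode z)) (fst (prod_decode (snd (prod_decode z))))
      (snd (prod_decode (snd (prod_decode z)))))"
  shows "semirec (derivable R0 R2)"
proof -
  have R2': "semirec (\<lambda>x. R2 (A x) (B x) (C x))" if "recursive A" "recursive B" "recursive C" for A B C
  proof -
    have "recursive (\<lambda>x. prod_encode (A x, prod_encode (B x, C x)))"
      by (intro recursive_intros that)
    from semirec_comp[OF R2 this] show ?thesis by simp
  qed
  have "derivable R0 R2 t \<longleftrightarrow> (\<exists>L n. entry L n = t \<and> (\<forall>i<Suc n. R0 (entry L i) \<or>
      (\<exists>j k. j < i \<and> k < i \<and> R2 (entry L i) (entry L j) (entry L k))))" (is "_ \<longleftrightarrow> (\<exists>L n. ?Q L n)") for t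
  proof
    assume "derivable R0 R2 t"
    then obtain ts where ts: "derivation R0 R2 (ts @ [t])" unfolding derivable_iff_derivation by blast
    obtain L where L: "\<forall>i<Suc (length ts). entry L i = (ts @ [t]) ! i" using ex_entry by blast
    have "?Q L (length ts)"
    proof (intro conjI allI impI)
      fix i assume i: "i < Suc (length ts)"
      with ts consider "R0 ((ts @ [t]) ! i)"
        | j k where "j < i" "k < i" "R2 ((ts @ [t]) ! i) ((ts @ [t]) ! j) ((ts @ [t]) ! k)"
        unfolding derivation_def by fastforce
      then show "R0 (entry L i) \<or> (\<exists>j k. j < i \<and> k < i \<and> R2 (entry L i) (entry L j) (entry L k))"
        by cases (use L i in \<open>metis order.strict_trans\<close>)+
    qed (use L in simp)
    then show "\<exists>L n. ?Q L n" by blast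
  next
    assume "\<exists>L n. ?Q L n"
    then obtain L n where Q: "?Q L n" by blast
    have "derivation R0 R2 (map (entry L) [0..<n] @ [t])"
    proof -
      have "map (entry L) [0..<n] @ [t] = map (entry L) [0..<Suc n]" using Q by simp
      moreover have "derivation R0 R2 (map (entry L) [0..<Suc n])"
        unfolding derivation_def
      proof (intro allI impI)
        let ?vs = "map (entry L) [0..<Suc n]"
        fix i assume "i < length ?vs"
        then have i: "i < Suc n" by simp
        have nth: "?vs ! j = entry L j" if "j \<le> i" for j
          using i that by (simp del: upt_Suc)
        from Q i have "R0 (entry L i) \<or> (\<exists>j k. j < i \<and> k < i \<and> R2 (entry L i) (entry L j) (entry L k))"
          by blast
        then show "R0 (?vs ! i) \<or> (\<exists>j k. j < i \<and> k < i \<and> R2 (?vs ! i) (?vs ! j) (?vs ! k))"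
          by (metis nth order.refl order.strict_implies_order)
      qed
      ultimately show ?thesis by simp
    qed
    then show "derivable R0 R2 t" unfolding derivable_iff_derivation by blast
  qed
  moreover have "semirec (\<lambda>t. \<exists>L n. entry L n = t \<and> (\<forall>i<Suc n. R0 (entry L i) \<or>
      (\<exists>j k. j < i \<and> k < i \<and> R2 (entry L i) (entry L j) (entry L k))))"
    by (intro recursive_intros R2' semirec_comp[OF R0])
  ultimately show ?thesis by (subst semirec_cong)
qed

section \<open>A universal semirecursive relation\<close>

primrec code :: "recf \<Rightarrow> nat" where
  "code Zero = prod_encode (0, 0)"
| "code Succ = prod_encode (1, 0)"
| "code (Proj i) = prod_encode (2, i)"
| "code (Comp f gs) = prod_encode (3, prod_encode (code f, list_encode (map code gs)))"
| "code (Prim f g) = prod_encode (4, prod_encode (code f, code g))"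
| "code (Mu f) = prod_encode (5, code f)"

text \<open>This is how \<open>list_encode\<close> codes a nonempty list; 0 codes the empty
  one.\<close>

abbreviation code_cons :: "nat \<Rightarrow> nat \<Rightarrow> nat" where
  "code_cons x X \<equiv> Suc (prod_encode (x, X))"

text \<open>The tag \<open>k\<close> separates four judgements: evaluation, evaluation of a list of
  terms, list lookup, and positivity of the body of a \<open>Mu\<close> below a bound.\<close>

definition fact4 :: "nat \<Rightarrow> nat \<Rightarrow> nat \<Rightarrow> nat \<Rightarrow> nat" where
  "fact4 k a b c = prod_encode (k, prod_encode (a, prod_encode (b, c)))"

lemma fact4_eq_iff [simp]:
  "fact4 k a b c = fact4 k' a' b' c' \<longleftrightarrow> k = k' \<and> a = a' \<and> b = b' \<and> c = c'"
  by (simp add: fact4_def)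

lemma recursive_fact4 [recursive_intros]:
  "recursive K \<Longrightarrow> recursive A \<Longrightarrow> recursive B \<Longrightarrow> recursive C \<Longrightarrow>
    recursive (\<lambda>x. fact4 (K x) (A x) (B x) (C x))"
  unfolding fact4_def by (intro recursive_intros)

abbreviation "eval_fact \<equiv> fact4 0"
abbreviation "evals_fact \<equiv> fact4 1"
abbreviation "nth_fact \<equiv> fact4 2"
abbreviation "pos_fact \<equiv> fact4 3"

inductive eval_axiom :: "nat \<Rightarrow> bool" where
  "eval_axiom (eval_fact (prod_encode (0, 0)) X 0)"
| "eval_axiom (eval_fact (prod_encode (1, 0)) (code_cons x X) (Suc x))"
| "eval_axiom (evals_fact 0 X 0)"
| "eval_axiom (nth_fact (code_cons x X) 0 x)"
| "eval_axiom (pos_fact F X 0)"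

text \<open>The auxiliary judgements unfold lookup, \<open>list_all2\<close> and the bounded
  quantifier of \<open>Mu\<close> one element at a time, so that two premises suffice. A clause with
  one premise leaves \<open>q\<close> free, and the same fact is then supplied twice.\<close>

inductive eval_rule :: "nat \<Rightarrow> nat \<Rightarrow> nat \<Rightarrow> bool" where
  nth_Suc: "eval_rule (nth_fact (code_cons x X) (Suc i) y) (nth_fact X i y) q"
| proj: "eval_rule (eval_fact (prod_encode (2, i)) X y) (nth_fact X i y) q"
| evals_cons: "eval_rule (evals_fact (code_cons G Gs) X (code_cons y Y))
    (eval_fact G X y) (evals_fact Gs X Y)"
| comp: "eval_rule (eval_fact (prod_encode (3, prod_encode (F, Gs))) X z)
    (evals_fact Gs X Y) (eval_fact F Y z)"
| prim0: "eval_rule (eval_fact (prod_encode (4, prod_encode (F, G))) (code_cons 0 X) z)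
    (eval_fact F X z) q"
| primS: "eval_rule (eval_fact (prod_encode (4, prod_encode (F, G))) (code_cons (Suc n) X) z)
    (eval_fact (prod_encode (4, prod_encode (F, G))) (code_cons n X) r)
    (eval_fact G (code_cons r (code_cons n X)) z)"
| pos_Suc: "eval_rule (pos_fact F X (Suc n)) (pos_fact F X n)
    (eval_fact F (code_cons n X) (Suc v))"
| mu: "eval_rule (eval_fact (prod_encode (5, F)) X n) (pos_fact F X n)
    (eval_fact F (code_cons n X) 0)"

abbreviation eval_derivable :: "nat \<Rightarrow> bool" where
  "eval_derivable \<equiv> derivable eval_axiom eval_rule"

lemmas eval_derivable_axiom = derivable.base[of eval_axiom _ eval_rule]
lemmas eval_derivable_infer = derivable.step[of eval_rule _ _ _ eval_axiom]

text \<open>The \<open>simps\<close> rules present axioms and clauses as finite disjunctions of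
  existentially quantified equations between recursive terms.\<close>

lemma semirec_eval_derivable: "semirec eval_derivable"
proof (rule semirec_derivable)
  show "semirec eval_axiom"
    unfolding eval_axiom.simps[abs_def] by (intro recursive_intros)
  show "semirec (\<lambda>z. eval_rule (fst (prod_decode z)) (fst (prod_decode (snd (prod_decode z))))
      (snd (prod_decode (snd (prod_decode z)))))"
    unfolding eval_rule.simps by (intro recursive_intros)
qed

lemma derivable_nth_fact:
  "i < length xs \<Longrightarrow>
    eval_derivable (nth_fact (list_encode xs) i (xs ! i))"
proof (induction xs arbitrary: i)
  case (Cons x xs)
  show ?case
  proof (cases i)
    case 0
    then show ?thesis by (auto intro!: eval_derivable_axiom eval_axiom.intros)
  next
    case (Suc j)
    with Cons have *: "eval_derivable (nth_fact (list_encode xs) j (xs ! j))" by simp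
    show ?thesis using eval_derivable_infer[OF nth_Suc * *] unfolding Suc by simp
  qed
qed simp

text \<open>Completeness of the clauses, with inner inductions along the list of terms for
  \<open>Comp\<close> and up to the result for \<open>Mu\<close>.\<close>

lemma derivable_eval_fact:
  "eval f xs y \<Longrightarrow>
    eval_derivable (eval_fact (code f) (list_encode xs) y)"
proof (induction rule: eval.induct)
  case (zero xs)
  show ?case by (auto intro!: eval_derivable_axiom eval_axiom.intros)
next
  case (succ x xs)
  show ?case using eval_derivable_axiom[OF eval_axiom.intros(2)] by simp
next
  case (proj i xs)
  then have *: "eval_derivable (nth_fact (list_encode xs) i (xs ! i))" by (rule derivable_nth_fact)
  show ?case using eval_derivable_infer[OF eval_rule.proj * *] by simp
next
  case (comp xs gs ys f z)
  from comp.IH(1) have "eval_derivable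
      (evals_fact (list_encode (map code gs)) (list_encode xs) (list_encode ys))"
  proof (induction rule: list_all2_induct)
    case Nil
    show ?case using eval_derivable_axiom[OF eval_axiom.intros(3)] by simp
  next
    case (Cons g gs y ys)
    then have "eval_derivable (eval_fact (code g) (list_encode xs) y)" by blast
    from eval_derivable_infer[OF evals_cons this Cons(3)] show ?case by simp
  qed
  from eval_derivable_infer[OF eval_rule.comp this comp.IH(2)] show ?case by simp
next
  case (prim0 f xs z g)
  from eval_derivable_infer[OF eval_rule.prim0 this(2) this(2)] show ?case by simp
next
  case (primS f g n xs r z)
  show ?case
    using eval_derivable_infer[OF eval_rule.primS primS.IH[unfolded code.simps list_encode.simps]]
    by simp
next
  case (mu f n xs)
  have "k \<le> n \<Longrightarrow> eval_derivable (pos_fact (code f) (list_encode xs) k)" for k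
  proof (induction k)
    case 0
    show ?case by (auto intro!: eval_derivable_axiom eval_axiom.intros)
  next
    case (Suc k)
    with mu.IH(2) obtain v where
      "eval_derivable (eval_fact (code f) (list_encode (k # xs)) v)" "0 < v"
      by (meson Suc_le_lessD)
    then show ?case using Suc eval_derivable_infer[OF pos_Suc]
      by (metis Suc_leD gr0_implies_Suc list_encode.simps(2))
  qed
  from eval_derivable_infer[OF eval_rule.mu this[OF order.refl]] mu.IH(1) show ?case by simp
qed

section \<open>Soundness of the clauses\<close>

lemma list_encode_eq_code_cons:
  "list_encode xs = code_cons x X \<longleftrightarrow> (\<exists>ys. xs = x # ys \<and> X = list_encode ys)"
  by (cases xs) auto

lemma list_encode_eq_0 [simp]: "list_encode xs = 0 \<longleftrightarrow> xs = []"
  by (cases xs) auto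

text \<open>Only facts about codes of actual terms are constrained. The clauses also derive facts
  about numbers that code no term, and these are sound vacuously.\<close>

definition sound :: "nat \<Rightarrow> bool" where
  "sound t \<longleftrightarrow>
    (\<forall>f xs y. eval_fact (code f) (list_encode xs) y = t \<longrightarrow> eval f xs y) \<and>
    (\<forall>gs xs ys. evals_fact (list_encode (map code gs)) (list_encode xs) (list_encode ys) = t \<longrightarrow>
      list_all2 (\<lambda>g y. eval g xs y) gs ys) \<and>
    (\<forall>xs i y. nth_fact (list_encode xs) i y = t \<longrightarrow> i < length xs \<and> xs ! i = y) \<and>
    (\<forall>f xs n. pos_fact (code f) (list_encode xs) n = t \<longrightarrow> (\<forall>k<n. \<exists>v. eval f (k # xs) v \<and> 0 < v))"

lemma sound_eval: "sound (eval_fact (code f) (list_encode xs) y) \<Longrightarrow> eval f xs y"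
  and sound_evals: "sound (evals_fact (list_encode (map code gs)) (list_encode xs) (list_encode ys)) \<Longrightarrow>
    list_all2 (\<lambda>g y. eval g xs y) gs ys"
  and sound_nth: "sound (nth_fact (list_encode xs) i y) \<Longrightarrow> i < length xs \<and> xs ! i = y"
  and sound_pos: "sound (pos_fact (code f) (list_encode xs) n) \<Longrightarrow>
    \<forall>k<n. \<exists>v. eval f (k # xs) v \<and> 0 < v"
  unfolding sound_def by blast+

lemma sound_eval_fact:
  "sound (eval_fact F X y) \<longleftrightarrow> (\<forall>f xs. code f = F \<longrightarrow> list_encode xs = X \<longrightarrow> eval f xs y)"
  unfolding sound_def by auto

lemma code_eq_iff:
  "code f = prod_encode (0, a) \<longleftrightarrow> f = Zero \<and> a = 0"
  "code f = prod_encode (1, a) \<longleftrightarrow> f = Succ \<and> a = 0"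
  "code f = prod_encode (2, a) \<longleftrightarrow> f = Proj a"
  "code f = prod_encode (3, prod_encode (a, b)) \<longleftrightarrow>
    (\<exists>g gs. f = Comp g gs \<and> a = code g \<and> b = list_encode (map code gs))"
  "code f = prod_encode (4, prod_encode (a, b)) \<longleftrightarrow>
    (\<exists>g h. f = Prim g h \<and> a = code g \<and> b = code h)"
  "code f = prod_encode (5, a) \<longleftrightarrow> (\<exists>g. f = Mu g \<and> a = code g)"
  by (cases f; auto)+

lemma sound_axiom: "eval_axiom t \<Longrightarrow> sound t"
  by (induction rule: eval_axiom.induct)
    (auto simp: sound_def code_eq_iff[unfolded One_nat_def] list_encode_eq_code_cons
      intro: eval.zero eval.succ)

lemma sound_rule:
  assumes "eval_rule t p q" and "sound p" and "sound q"
  shows "sound t"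
  using assms
proof (cases rule: eval_rule.cases)
  case (nth_Suc x X i y)
  with assms(2) show ?thesis
    by (auto simp: sound_def list_encode_eq_code_cons)
next
  case (proj i X y)
  have "eval (Proj i) xs y" if "X = list_encode xs" for xs
    using sound_nth[of xs i y] assms(2) eval.proj[of i xs] unfolding proj that by auto
  then show ?thesis unfolding proj sound_eval_fact code_eq_iff by blast
next
  case (evals_cons G Gs X y Y)
  show ?thesis
    unfolding evals_cons sound_def
  proof (simp, intro allI impI)
    fix gs xs ys
    assume eq: "list_encode (map code gs) = code_cons G Gs \<and> list_encode xs = X \<and>
      list_encode ys = code_cons y Y"
    then obtain g gs' ys' where "gs = g # gs'" "G = code g" "Gs = list_encode (map code gs')"
      "ys = y # ys'" "Y = list_encode ys'"
      by (auto simp: list_encode_eq_code_cons)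
    with eq assms(2,3) show "list_all2 (\<lambda>g. eval g xs) gs ys"
      using sound_eval[of g xs y] sound_evals[of gs' xs ys'] unfolding evals_cons by auto
  qed
next
  case (comp F Gs X z Y)
  have "eval (Comp f gs) xs z"
    if "F = code f" "Gs = list_encode (map code gs)" "X = list_encode xs" for f gs xs
    \<comment> \<open>Every number codes a list, so \<open>list_decode Y\<close> supplies the
      intermediate values.\<close>
    using sound_evals[of gs xs "list_decode Y"] sound_eval[of f "list_decode Y" z] assms(2,3)
    unfolding comp that by (auto intro: eval.comp)
  then show ?thesis unfolding comp sound_eval_fact code_eq_iff by blast
next
  case (prim0 F G X z)
  have "eval (Prim f g) (0 # xs) z" if "F = code f" "G = code g" "X = list_encode xs" for f g xs
    using sound_eval[of f xs z] assms(2) unfolding prim0 that by (auto intro: eval.prim0)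
  then show ?thesis
    unfolding prim0 sound_eval_fact code_eq_iff list_encode_eq_code_cons by blast
next
  case (primS F G n X z r)
  have "eval (Prim f g) (Suc n # xs) z" if "F = code f" "G = code g" "X = list_encode xs" for f g xs
    using sound_eval[of "Prim f g" "n # xs" r] sound_eval[of g "r # n # xs" z] assms(2,3)
    unfolding primS that by (auto intro: eval.primS)
  then show ?thesis
    unfolding primS sound_eval_fact code_eq_iff list_encode_eq_code_cons by blast
next
  case (pos_Suc F X n v)
  have "\<exists>v. eval f (k # xs) v \<and> 0 < v"
    if "F = code f" "X = list_encode xs" "k < Suc n" for f xs k
    using sound_pos[of f xs n] sound_eval[of f "n # xs" "Suc v"] assms(2,3) that(3)
    unfolding pos_Suc that by (auto simp: less_Suc_eq)
  then show ?thesis unfolding pos_Suc sound_def by auto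
next
  case (mu F X n)
  have "eval (Mu f) xs n" if "F = code f" "X = list_encode xs" for f xs
    using sound_pos[of f xs n] sound_eval[of f "n # xs" 0] assms(2,3)
    unfolding mu that by (auto intro: eval.mu)
  then show ?thesis unfolding mu sound_eval_fact code_eq_iff by blast
qed

lemma derivable_eval_fact_iff:
  "eval_derivable (eval_fact (code f) (list_encode xs) y) \<longleftrightarrow> eval f xs y"
proof
  assume "eval_derivable (eval_fact (code f) (list_encode xs) y)"
  then have "sound (eval_fact (code f) (list_encode xs) y)"
    by induction (auto intro: sound_axiom sound_rule)
  then show "eval f xs y" by (rule sound_eval)
qed (rule derivable_eval_fact)

definition universal :: "nat \<Rightarrow> nat \<Rightarrow> nat \<Rightarrow> bool" where
  "universal e x y \<longleftrightarrow> eval_derivable (eval_fact e (code_cons x 0) y)"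

lemma universal_code: "universal (code f) x y \<longleftrightarrow> eval f [x] y"
  using derivable_eval_fact_iff[of f "[x]" y] by (simp add: universal_def)

lemma semirec_universal [recursive_intros]:
  "recursive E \<Longrightarrow> recursive A \<Longrightarrow> recursive B \<Longrightarrow>
    semirec (\<lambda>x. universal (E x) (A x) (B x))"
  unfolding universal_def by (intro semirec_comp[OF semirec_eval_derivable] recursive_intros)

text \<open>For the converse, the domain of \<open>f\<close> is a projection of the semirecursive
  relation \<open>universal (code f)\<close>.\<close>

lemma semirec_iff_domain: "semirec P \<longleftrightarrow> (\<exists>f. \<forall>x. P x \<longleftrightarrow> (\<exists>v. eval f [x] v))"
proof
  assume "\<exists>f. \<forall>x. P x \<longleftrightarrow> (\<exists>v. eval f [x] v)"
  then obtain f where f: "\<And>x. P x \<longleftrightarrow> (\<exists>v. universal (code f) x v)"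
    unfolding universal_code by auto
  show "semirec P" by (subst semirec_cong[OF f]) (intro recursive_intros)
qed (rule semirec_domain)

section \<open>Injective increasing reductions\<close>

text \<open>The numerical form of length-boundedness: a constant factor in the code is an additive
  constant in the length.\<close>

definition linear_bounded :: "(nat \<Rightarrow> nat) \<Rightarrow> bool" where
  "linear_bounded F \<longleftrightarrow> (\<exists>C. \<forall>x. F x \<le> C * Suc x)"

definition linear_reduction :: "(nat \<Rightarrow> nat) \<Rightarrow> (nat \<Rightarrow> bool) \<Rightarrow> (nat \<Rightarrow> bool) \<Rightarrow> bool" where
  "linear_reduction F A B \<longleftrightarrow> recursive F \<and> linear_bounded F \<and> (\<forall>x. A x \<longleftrightarrow> B (F x))"

text \<open>Prefixing a string by a code must cost only a constant in length, so the code may be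
  exponential but the argument has to enter linearly.\<close>

definition input :: "nat \<Rightarrow> nat \<Rightarrow> nat" where
  "input e i = 2 ^ e * (2 * i + 1)"

lemma recursive_input [recursive_intros]:
  "recursive E \<Longrightarrow> recursive I \<Longrightarrow> recursive (\<lambda>x. input (E x) (I x))"
  unfolding input_def by (intro recursive_intros)

lemma even_input_iff: "even (input e i) \<longleftrightarrow> e \<noteq> 0"
  by (simp add: input_def)

text \<open>Parity detects whether a factor 2 remains; cancelling it lowers both exponents.\<close>

lemma input_inject: "input e i = input e' i' \<Longrightarrow> e = e' \<and> i = i'"
proof (induction e arbitrary: e')
  case 0
  then have "e' = 0" by (metis even_input_iff)
  with 0 show ?case by (simp add: input_def)
next
  case (Suc e)
  then have "e' \<noteq> 0" by (metis even_input_iff nat.distinct(1))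
  then obtain d where d: "e' = Suc d" by (cases e') auto
  with Suc.prems have "input e i = input d i'" by (simp add: input_def)
  from Suc.IH[OF this] d show ?case by simp
qed

lemma input_eq_iff [simp]: "input e i = input e' i' \<longleftrightarrow> e = e' \<and> i = i'"
  using input_inject by blast

text \<open>The program is run on inputs that carry its own code: this is the self-reference of the
  diagonal argument.\<close>

definition outcome :: "nat \<Rightarrow> nat \<Rightarrow> nat \<Rightarrow> bool" where
  "outcome e i y \<longleftrightarrow> universal e (input e i) y"

lemma semirec_outcome [recursive_intros]:
  "recursive E \<Longrightarrow> recursive I \<Longrightarrow> recursive Y \<Longrightarrow>
    semirec (\<lambda>x. outcome (E x) (I x) (Y x))"
  unfolding outcome_def by (intro recursive_intros)

text \<open>Coded without assuming that the function with code \<open>e\<close> is total, so that the relation is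
  semirecursive uniformly in \<open>e\<close>.\<close>

definition rank :: "nat \<Rightarrow> nat \<Rightarrow> nat \<Rightarrow> bool" where
  "rank e i r \<longleftrightarrow> (\<exists>L. entry L 0 = 0 \<and> entry L i = r \<and>
    (\<forall>j<i. \<exists>y. outcome e j y \<and>
      (j < 4 * y \<and> entry L (Suc j) = Suc (entry L j) \<or>
       4 * y < Suc j \<and> entry L (Suc j) = entry L j)))"

lemma semirec_rank [recursive_intros]:
  assumes "recursive E" and "recursive I" and "recursive R"
  shows "semirec (\<lambda>x. rank (E x) (I x) (R x))"
  unfolding rank_def
  by (intro recursive_intros recursive_comp[OF assms(1)] recursive_comp[OF assms(2)]
      recursive_comp[OF assms(3)])

definition good_count :: "(nat \<Rightarrow> nat) \<Rightarrow> nat \<Rightarrow> nat" where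
  "good_count h i = card {j. j < i \<and> j < 4 * h j}"

lemma good_count_0 [simp]: "good_count h 0 = 0"
  by (simp add: good_count_def)

lemma good_count_Suc [simp]:
  "good_count h (Suc j) = (if j < 4 * h j then Suc (good_count h j) else good_count h j)"
proof -
  have "{k. k < Suc j \<and> k < 4 * h k} =
      (if j < 4 * h j then insert j {k. k < j \<and> k < 4 * h k} else {k. k < j \<and> k < 4 * h k})"
    by (auto simp: less_Suc_eq)
  then show ?thesis by (simp add: good_count_def)
qed

text \<open>If the outcomes form the graph of a total \<open>h\<close>, the entries of
  \<open>L\<close> up to \<open>i\<close> are forced to be the values of
  \<open>good_count h\<close>.\<close>

lemma rank_iff:
  assumes "\<And>i y. outcome e i y \<longleftrightarrow> y = h i"
  shows "rank e i r \<longleftrightarrow> r = good_count h i"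
proof -
  have rank: "rank e i r \<longleftrightarrow> (\<exists>L. entry L 0 = 0 \<and> entry L i = r \<and>
    (\<forall>j<i. entry L (Suc j) = (if j < 4 * h j then Suc (entry L j) else entry L j)))"
    unfolding rank_def assms by (simp add: less_Suc_eq_le not_less if_bool_eq_disj) (metis not_le)
  show ?thesis
  proof
    assume "rank e i r"
    then obtain L where L: "entry L 0 = 0" "entry L i = r" and
      step: "\<And>j. j < i \<Longrightarrow> entry L (Suc j) = (if j < 4 * h j then Suc (entry L j) else entry L j)"
      unfolding rank by blast
    have "j \<le> i \<Longrightarrow> entry L j = good_count h j" for j
      by (induction j) (simp_all add: L step)
    with L(2) show "r = good_count h i" by simp
  next
    assume r: "r = good_count h i"
    obtain L where L: "\<forall>j<Suc i. entry L j = good_count h j" using ex_entry by blast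
    then have "entry L 0 = 0" and "entry L i = r" by (simp_all add: r)
    moreover have "\<forall>j<i. entry L (Suc j) = (if j < 4 * h j then Suc (entry L j) else entry L j)"
      using L by simp
    ultimately show "rank e i r" unfolding rank by blast
  qed
qed

text \<open>All conditions are positive in \<open>outcome\<close>: even distinctness is witnessed by
  two computed values. So the set is semirecursive although some codes give partial
  functions.\<close>

definition diagonal :: "(nat \<Rightarrow> bool) \<Rightarrow> nat \<Rightarrow> bool" where
  "diagonal A z \<longleftrightarrow> (\<exists>e i. z = input e i \<and>
    (\<forall>j<i. \<exists>y y'. outcome e j y \<and> outcome e i y' \<and> y \<noteq> y') \<and>
    ((\<exists>x. rank e i (4 * x) \<and> A x) \<or> (\<exists>j y. i < j \<and> outcome e i y \<and> outcome e j y)))"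

lemma semirec_diagonal:
  assumes "semirec A"
  shows "semirec (diagonal A)"
  unfolding diagonal_def[abs_def] by (intro recursive_intros semirec_comp[OF assms])

lemma diagonal_input:
  "diagonal A (input e i) \<longleftrightarrow>
    (\<forall>j<i. \<exists>y y'. outcome e j y \<and> outcome e i y' \<and> y \<noteq> y') \<and>
    ((\<exists>x. rank e i (4 * x) \<and> A x) \<or> (\<exists>j y. i < j \<and> outcome e i y \<and> outcome e j y))"
  unfolding diagonal_def by simp

text \<open>A bad index \<open>j < i\<close> has \<open>h j \<le> i div 4\<close>, so injectivity
  allows at most \<open>i div 4 + 1\<close> of them.\<close>

lemma inj_linear_density:
  fixes h :: "nat \<Rightarrow> nat"
  assumes "inj h"
  shows "3 * i \<le> 4 * good_count h i + 4"
proof -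
  have "card {j. j < i \<and> 4 * h j \<le> j} \<le> card {..i div 4}"
  proof (rule card_inj_on_le)
    show "inj_on h {j. j < i \<and> 4 * h j \<le> j}" using assms by (rule inj_on_subset) simp
  qed auto
  moreover have "i = card {j. j < i \<and> j < 4 * h j} + card {j. j < i \<and> 4 * h j \<le> j}"
  proof -
    have "{j. j < i \<and> j < 4 * h j} \<union> {j. j < i \<and> 4 * h j \<le> j} = {..<i}" by auto
    moreover have "card ({j. j < i \<and> j < 4 * h j} \<union> {j. j < i \<and> 4 * h j \<le> j}) =
        card {j. j < i \<and> j < 4 * h j} + card {j. j < i \<and> 4 * h j \<le> j}"
      by (rule card_Un_disjoint) auto
    ultimately show ?thesis by (metis card_lessThan)
  qed
  ultimately show ?thesis unfolding card_atMost good_count_def by linarith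
qed

text \<open>The count is unbounded and rises by one exactly after a good index, so the step at which
  it first exceeds \<open>r\<close> starts at the required index.\<close>

lemma ex_good_count:
  fixes h :: "nat \<Rightarrow> nat"
  assumes "inj h"
  shows "\<exists>i. good_count h i = r \<and> i < 4 * h i"
proof -
  define n where "n = 4 * r + 4"
  have "3 * n \<le> 4 * good_count h n + 4" by (rule inj_linear_density[OF assms])
  then have ex: "r < good_count h n" unfolding n_def by simp
  define i where "i = (LEAST i. r < good_count h i)"
  have i: "r < good_count h i" unfolding i_def using ex by (rule LeastI)
  then obtain k where k: "i = Suc k" by (cases i) auto
  then have "\<not> r < good_count h k" unfolding i_def by (intro not_less_Least) simp
  with i k have "good_count h k = r \<and> k < 4 * h k" by (simp split: if_splits)
  then show ?thesis by blast
qed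

lemma good_count_less: "a < b \<Longrightarrow> a < 4 * h a \<Longrightarrow> good_count h a < good_count h b"
  unfolding good_count_def by (rule psubset_card_mono) auto

lemma good_count_le: "good_count h i \<le> i"
  by (induction i) auto

text \<open>The two factors 4 cooperate: \<open>4 * x \<le> I x < 4 * h (I x)\<close> gives growth,
  while density keeps \<open>I x\<close> linear in \<open>x\<close>.\<close>

lemma increasing_reduction:
  assumes A: "semirec A" and B: "\<And>W. semirec W \<Longrightarrow> \<exists>F. linear_reduction F W B"
  shows "\<exists>F. linear_reduction F A B \<and> inj F \<and> (\<forall>x. x < F x)"
proof -
  obtain H where H: "recursive H" "linear_bounded H" and red: "\<And>x. diagonal A x \<longleftrightarrow> B (H x)"
    using B[OF semirec_diagonal[OF A]] unfolding linear_reduction_def by blast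
  obtain f where f: "\<And>x. eval f [x] (H x)" using H(1) unfolding recursive_def by auto
  \<comment> \<open>\<open>diagonal A\<close> was fixed before \<open>H\<close>; as it treats all
    codes, it also treats the code of this very reduction.\<close>
  define e where "e = code f"
  define h where "h i = H (input e i)" for i
  have out: "outcome e i y \<longleftrightarrow> y = h i" for i y
    unfolding outcome_def e_def universal_code h_def using f eval_deterministic by blast
  note rank = rank_iff[OF out]
  have inj: "inj h"
  proof (rule linorder_injI)
    fix i j :: nat assume "i < j"
    show "h i \<noteq> h j"
    proof
      assume eq: "h i = h j"
      \<comment> \<open>The first index with the colliding value is put into the set, since
        \<open>j\<close> collides with it later; \<open>j\<close> itself is left out, since
        \<open>m\<close> collides with it earlier.\<close>
      define m where "m = (LEAST m. h m = h j)"
      have m: "h m = h j" "m \<le> i" unfolding m_def using eq by (auto intro: LeastI Least_le)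
      have "\<forall>k<m. h k \<noteq> h m" unfolding m(1) unfolding m_def by (blast dest: not_less_Least)
      moreover have "\<exists>k y. m < k \<and> y = h m \<and> y = h k"
        using m \<open>i < j\<close> by (intro exI[of _ j] exI[of _ "h m"]) simp
      ultimately have "diagonal A (input e m)"
        unfolding diagonal_input out by metis
      moreover have "\<not> diagonal A (input e j)"
        unfolding diagonal_input out using m \<open>i < j\<close> by auto
      ultimately show False using red m(1) unfolding h_def by metis
    qed
  qed
  \<comment> \<open>Without collisions, only the condition on \<open>rank\<close> is left.\<close>
  have diag: "diagonal A (input e i) \<longleftrightarrow> (\<exists>x. 4 * x = good_count h i \<and> A x)" for i
    unfolding diagonal_input out rank using inj by (auto simp: inj_eq)
  obtain I where I: "\<And>x. good_count h (I x) = 4 * x" "\<And>x. I x < 4 * h (I x)"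
    using ex_good_count[OF inj, of "4 * _"] by metis
  have I_unique: "i = I x" if "good_count h i = 4 * x" "i < 4 * h i" for i x
  proof -
    show ?thesis
      using good_count_less[of i "I x" h] good_count_less[of "I x" i h] that I[of x]
      by (metis less_irrefl linorder_neqE_nat)
  qed
  let ?F = "\<lambda>x. h (I x)"
  have "recursive ?F"
  proof (rule recursive_graph)
    \<comment> \<open>Indices with equal count form a run in which only the last is good;
      \<open>i < 4 * y\<close> selects it.\<close>
    have "?F x = y \<longleftrightarrow> (\<exists>i. rank e i (4 * x) \<and> outcome e i y \<and> i < 4 * y)" for x y
    proof
      assume "?F x = y"
      with I[of x] show "\<exists>i. rank e i (4 * x) \<and> outcome e i y \<and> i < 4 * y"
        unfolding rank out by (intro exI[of _ "I x"]) simp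
    next
      assume "\<exists>i. rank e i (4 * x) \<and> outcome e i y \<and> i < 4 * y"
      then obtain i where i: "good_count h i = 4 * x" "i < 4 * h i" and y: "y = h i"
        unfolding rank out by auto
      show "?F x = y" unfolding y I_unique[OF i, symmetric] ..
    qed
    then show "semirec (\<lambda>z. ?F (fst (prod_decode z)) = snd (prod_decode z))"
      by (subst semirec_cong) (assumption, intro recursive_intros)
  qed
  moreover have "inj ?F"
  proof (rule injI)
    fix x y assume "?F x = ?F y"
    with inj have "I x = I y" by (rule injD)
    then have "4 * x = 4 * y" unfolding I(1)[symmetric] by (rule arg_cong)
    then show "x = y" by simp
  qed
  moreover have "x < ?F x" for x
  proof -
    have "4 * x \<le> I x" using good_count_le[of h "I x"] unfolding I(1) .
    with I(2)[of x] show ?thesis by linarith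
  qed
  moreover have "A x \<longleftrightarrow> B (?F x)" for x
  proof -
    have "diagonal A (input e (I x)) \<longleftrightarrow> A x" unfolding diag I(1) by simp
    then show ?thesis unfolding red h_def by simp
  qed
  moreover have "linear_bounded ?F"
  proof -
    obtain C where C: "\<And>z. H z \<le> C * Suc z" using H(2) unfolding linear_bounded_def by blast
    have "?F x \<le> (C * (2 ^ e * 16 + 1)) * Suc x" for x
    proof -
      \<comment> \<open>Density at \<open>I x\<close>, where the count is \<open>4 * x\<close>,
        reads \<open>3 * I x \<le> 16 * x + 4\<close>.\<close>
      have "I x \<le> 6 * x + 2" using inj_linear_density[OF inj, of "I x"] unfolding I(1) by simp
      then have "input e (I x) \<le> 2 ^ e * (16 * Suc x)"
        unfolding input_def by (intro mult_le_mono2) simp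
      then have "Suc (input e (I x)) \<le> (2 ^ e * 16 + 1) * Suc x" by (simp add: algebra_simps)
      then have "C * Suc (input e (I x)) \<le> C * ((2 ^ e * 16 + 1) * Suc x)" by (rule mult_le_mono2)
      with C[of "input e (I x)"] show ?thesis unfolding h_def mult.assoc by (rule order.trans)
    qed
    then show ?thesis unfolding linear_bounded_def by blast
  qed
  ultimately show ?thesis
    unfolding linear_reduction_def by (intro exI[of _ ?F] conjI allI)
qed

section \<open>Computable Cantor-Bernstein construction\<close>

text \<open>Whether tracing back from a point of the domain of \<open>F\<close> ends in that domain or in the
  domain of \<open>G\<close>. Both cases are defined positively, so that both are semirecursive.\<close>

definition forward_origin :: "(nat \<Rightarrow> nat) \<Rightarrow> (nat \<Rightarrow> nat) \<Rightarrow> nat \<Rightarrow> bool" where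
  "forward_origin F G = derivable (\<lambda>t. \<forall>y<t. G y \<noteq> t) (\<lambda>t p q. t = G (F p))"

definition backward_origin :: "(nat \<Rightarrow> nat) \<Rightarrow> (nat \<Rightarrow> nat) \<Rightarrow> nat \<Rightarrow> bool" where
  "backward_origin F G =
    derivable (\<lambda>t. \<exists>y. G y = t \<and> (\<forall>x<y. F x \<noteq> y)) (\<lambda>t p q. t = G (F p))"

text \<open>The base cases search below a bound, which keeps them semirecursive. For increasing
  \<open>F\<close> and \<open>G\<close> this amounts to lying outside the range.\<close>

lemma semirec_origin:
  assumes F: "recursive F" and G: "recursive G"
  shows "semirec (forward_origin F G)" and "semirec (backward_origin F G)"
  unfolding forward_origin_def backward_origin_def
  by (intro semirec_derivable recursive_intros recursive_comp[OF F] recursive_comp[OF G])+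

text \<open>\<open>F\<close> is used on points of forward origin and the inverse of \<open>G\<close>
  on the others.\<close>

lemma increasing_cantor_bernstein:
  assumes F: "linear_reduction F A B" "inj F" "\<And>x. x < F x"
    and G: "linear_reduction G B A" "inj G" "\<And>x. x < G x"
  shows "\<exists>H. bij H \<and> linear_reduction H A B \<and> linear_bounded (inv H)"
proof -
  let ?X = "forward_origin F G" and ?Y = "backward_origin F G"
  have rec: "recursive F" "recursive G" and red: "\<And>x. A x \<longleftrightarrow> B (F x)" "\<And>y. B y \<longleftrightarrow> A (G y)"
    using F(1) G(1) unfolding linear_reduction_def by blast+
  have X: "?X x \<longleftrightarrow> (\<forall>y<x. G y \<noteq> x) \<or> (\<exists>p. x = G (F p) \<and> ?X p)" for x
    unfolding forward_origin_def by (subst derivable.simps) blast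
  have Y: "?Y x \<longleftrightarrow> (\<exists>y. G y = x \<and> (\<forall>z<y. F z \<noteq> y)) \<or> (\<exists>p. x = G (F p) \<and> ?Y p)" for x
    unfolding backward_origin_def by (subst derivable.simps) blast
  \<comment> \<open>\<open>G (F p)\<close> lies in the range of \<open>G\<close>, and its preimage
    \<open>F p\<close> in that of \<open>F\<close>, so no base case applies; injectivity identifies
    the premise as \<open>p\<close>.\<close>
  have X_step: "?X (G (F p)) \<longleftrightarrow> ?X p" and Y_step: "?Y (G (F p)) \<longleftrightarrow> ?Y p" for p
    using X[of "G (F p)"] Y[of "G (F p)"] F(2,3) G(2,3) by (metis inj_eq)+
  have Y_iff: "?Y x \<longleftrightarrow> \<not> ?X x" for x
  proof (induction x rule: less_induct)
    case (less x)
    show ?case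
    proof (cases "x \<in> range G")
      case False
      then have "?X x" using X[of x] by blast
      moreover have "\<not> ?Y x" using Y[of x] False by blast
      ultimately show ?thesis by blast
    next
      case True
      then obtain y where x: "x = G y" by blast
      show ?thesis
      proof (cases "y \<in> range F")
        case True
        then obtain p where y: "y = F p" by blast
        have "p < x" unfolding x y using F(3)[of p] G(3)[of "F p"] by simp
        from less.IH[OF this] show ?thesis unfolding x y X_step Y_step .
      next
        case False
        then have "?Y x" using Y[of x] x by blast
        moreover have "\<not> ?X x"
          using X[of x] False G(3)[of y] G(2) unfolding x by (metis inj_eq rangeI)
        ultimately show ?thesis by blast
      qed
    qed
  qed
  have range_G: "G (inv G x) = x" if "\<not> ?X x" for x
    using X[of x] that by (metis f_inv_into_f rangeI)
  define H where "H x = (if ?X x then F x else inv G x)" for x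
  have H_X: "H x = F x" if "?X x" for x using that by (simp add: H_def)
  have H_notX: "H (G y) = y" if "\<not> ?X (G y)" for y using that G(2) by (simp add: H_def)
  have H_cases: "?X x \<and> y = F x \<or> \<not> ?X x \<and> x = G y" if "H x = y" for x y
    using that range_G[of x] unfolding H_def by (auto split: if_splits)
  have inj_H: "inj H"
  proof (rule injI)
    fix x z assume "H x = H z"
    then show "x = z"
      using H_cases[of x "H x"] H_cases[of z "H z"] F(2) X_step by (metis inj_eq)
  qed
  have surj_H: "surj H"
  proof (rule surjI)
    fix y
    \<comment> \<open>The origin of \<open>G y\<close> tells which branch of \<open>H\<close>
      reaches \<open>y\<close>.\<close>
    show "H (if ?X (G y) then inv F y else G y) = y"
    proof (cases "?X (G y)")
      case True
      with X[of "G y"] G(2,3) obtain p where "y = F p" "?X p" by (metis inj_eq)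
      with True F(2) show ?thesis by (simp add: H_X)
    qed (simp add: H_notX)
  qed
  have bij: "bij H" using inj_H surj_H by (simp add: bij_def)
  have "recursive H"
  proof (rule recursive_graph)
    \<comment> \<open>Both negation and \<open>inv G\<close> disappear: \<open>?Y x\<close> replaces
      the failure of \<open>?X x\<close>, and \<open>G y = x\<close> says that \<open>y\<close> is
      the preimage.\<close>
    have "H x = y \<longleftrightarrow> ?X x \<and> F x = y \<or> ?Y x \<and> G y = x" for x y
      using H_cases[of x y] H_X[of x] H_notX[of y] Y_iff[of x] by metis
    then show "semirec (\<lambda>z. H (fst (prod_decode z)) = snd (prod_decode z))"
      by (subst semirec_cong) (assumption, intro recursive_intros recursive_comp[OF rec(1)]
        recursive_comp[OF rec(2)] semirec_comp[OF semirec_origin(1)[OF rec]]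
        semirec_comp[OF semirec_origin(2)[OF rec]])
  qed
  moreover have "A x \<longleftrightarrow> B (H x)" for x
    using H_cases[of x "H x"] red by metis
  moreover have "linear_bounded H"
  proof -
    obtain C where C: "\<And>x. F x \<le> C * Suc x"
      using F(1) unfolding linear_reduction_def linear_bounded_def by blast
    \<comment> \<open>On the second branch \<open>x = G (H x)\<close>, so
      \<open>H x < x\<close>.\<close>
    have "H x \<le> Suc C * Suc x" for x
      using H_cases[of x "H x"] C[of x] G(3)[of "H x"] by auto
    then show ?thesis unfolding linear_bounded_def by blast
  qed
  moreover have "linear_bounded (inv H)"
  proof -
    obtain C where C: "\<And>y. G y \<le> C * Suc y"
      using G(1) unfolding linear_reduction_def linear_bounded_def by blast
    \<comment> \<open>Now the branch of \<open>F\<close> is the decreasing one: there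
      \<open>y = F (inv H y)\<close>.\<close>
    have "inv H y \<le> Suc C * Suc y" for y
      using H_cases[of "inv H y" y] C[of y] F(3)[of "inv H y"] surj_f_inv_f[OF surj_H, of y] by auto
    then show ?thesis unfolding linear_bounded_def by blast
  qed
  ultimately show ?thesis using bij unfolding linear_reduction_def by blast
qed

section \<open>Transfer to binary strings\<close>

lemma inj_enc: "inj enc"
proof (rule injI)
  fix x y show "enc x = enc y \<Longrightarrow> x = y"
  proof (induction x arbitrary: y)
    case Nil
    then show ?case by (cases y) (auto split: if_split_asm)
  next
    case (Cons b x)
    then obtain c z where y: "y = c # z" by (cases y) (auto split: if_split_asm)
    with Cons.prems have eq: "2 * enc x + (if b then 2 else 1) = 2 * enc z + (if c then 2 else 1)"
      by simp
    then have "b = c" by (cases b; cases c) (simp_all, presburger+)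
    with eq Cons.IH y show ?case by simp
  qed
qed

lemma surj_enc: "surj enc"
proof -
  have "\<exists>x. enc x = n" for n
  proof (induction n rule: less_induct)
    case (less n)
    show ?case
    proof (cases "n = 0")
      case True
      then show ?thesis by (intro exI[of _ "[]"]) simp
    next
      case False
      then have "(n - 1) div 2 < n" by simp
      with less obtain x where "enc x = (n - 1) div 2" by blast
      with False have "enc (even n # x) = n" by (cases "even n") (auto elim!: evenE oddE)
      then show ?thesis by blast
    qed
  qed
  then show ?thesis by (metis surjI)
qed

lemma bij_enc: "bij enc"
  using inj_enc surj_enc by (simp add: bij_def)

lemma inv_enc_enc [simp]: "inv enc (enc x) = x"
  using inj_enc by simp

lemma enc_inv_enc [simp]: "enc (inv enc n) = n"
  using surj_enc by (rule surj_f_inv_f)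

lemma all_nat_iff_all_enc: "(\<forall>n. P n) \<longleftrightarrow> (\<forall>x. P (enc x))"
proof
  assume *: "\<forall>x. P (enc x)"
  show "\<forall>n. P n"
  proof
    fix n
    from * have "P (enc (inv enc n))" by blast
    then show "P n" by simp
  qed
qed blast

text \<open>In bijective base 2, strings of length \<open>l\<close> fill the interval from
  \<open>2 ^ l - 1\<close> to \<open>2 ^ Suc l - 2\<close>.\<close>

lemma enc_length_bounds: "2 ^ length x \<le> Suc (enc x)" "Suc (enc x) < 2 ^ Suc (length x)"
  by (induction x) auto

definition nat_conj :: "(bool list \<Rightarrow> bool list) \<Rightarrow> nat \<Rightarrow> nat" where
  "nat_conj h n = enc (h (inv enc n))"

lemma computable_iff_recursive: "computable h \<longleftrightarrow> recursive (nat_conj h)"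
  by (simp only: computable_def recursive_def all_nat_iff_all_enc nat_conj_def inv_enc_enc)

lemma enumerable_iff_semirec: "enumerable W \<longleftrightarrow> semirec (\<lambda>n. inv enc n \<in> W)"
  by (simp only: enumerable_def semirec_iff_domain all_nat_iff_all_enc inv_enc_enc)

lemma length_bounded_iff_linear_bounded: "length_bounded h \<longleftrightarrow> linear_bounded (nat_conj h)"
proof
  assume "length_bounded h"
  then obtain c where c: "\<And>x. length (h x) \<le> length x + c" unfolding length_bounded_def by blast
  have "nat_conj h (enc x) \<le> 2 ^ Suc c * Suc (enc x)" for x
  proof -
    have "Suc (enc (h x)) < 2 ^ Suc (length (h x))" by (rule enc_length_bounds)
    also have "\<dots> \<le> 2 ^ Suc (length x + c)" using c[of x] by (intro power_increasing) simp_all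
    also have "\<dots> = 2 ^ Suc c * 2 ^ length x" by (simp add: power_add)
    also have "\<dots> \<le> 2 ^ Suc c * Suc (enc x)" by (intro mult_le_mono2 enc_length_bounds)
    finally show ?thesis by (simp add: nat_conj_def)
  qed
  then show "linear_bounded (nat_conj h)"
    unfolding linear_bounded_def all_nat_iff_all_enc by blast
next
  assume "linear_bounded (nat_conj h)"
  then obtain C where C: "\<And>n. nat_conj h n \<le> C * Suc n" unfolding linear_bounded_def by blast
  \<comment> \<open>\<open>Suc C < 2 ^ Suc C\<close> absorbs the factor; one further unit comes from
    the upper bound on \<open>enc x\<close>.\<close>
  have "length (h x) \<le> length x + (C + 2)" for x
  proof -
    have "2 ^ length (h x) \<le> Suc (enc (h x))" by (rule enc_length_bounds)
    also have "\<dots> \<le> Suc C * Suc (enc x)" using C[of "enc x"] by (simp add: nat_conj_def)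
    also have "\<dots> < 2 ^ Suc C * 2 ^ Suc (length x)"
      by (intro mult_strict_mono enc_length_bounds less_exp) simp_all
    also have "\<dots> = 2 ^ (length x + (C + 2))" by (simp add: power_add)
    finally have "length (h x) < length x + (C + 2)" by (rule power_less_imp_less_exp[rotated]) simp
    then show ?thesis by simp
  qed
  then show "length_bounded h" unfolding length_bounded_def by blast
qed

lemma m_optimal_linear_reduction:
  assumes "m_optimal S" and "semirec W"
  shows "\<exists>F. linear_reduction F W (\<lambda>n. inv enc n \<in> S)"
proof -
  have "enumerable {x. W (enc x)}"
    using assms(2) by (simp add: enumerable_iff_semirec)
  then obtain h where "computable h" "length_bounded h" "\<forall>x. W (enc x) \<longleftrightarrow> h x \<in> S"
    using assms(1) unfolding m_optimal_def by auto
  then have "linear_reduction (nat_conj h) W (\<lambda>n. inv enc n \<in> S)"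
    by (simp add: linear_reduction_def computable_iff_recursive length_bounded_iff_linear_bounded
        all_nat_iff_all_enc[of "\<lambda>n. W n \<longleftrightarrow> _ n"] nat_conj_def)
  then show ?thesis by blast
qed

theorem theorem2p12:
  fixes S S' :: "bool list set"
  assumes "m_optimal S" and "m_optimal S'"
  shows "\<exists>h. bij h \<and> computable h \<and> length_bounded h \<and> length_bounded (inv h)
             \<and> (\<forall>x. x \<in> S \<longleftrightarrow> h x \<in> S')"
proof -
  let ?A = "\<lambda>n. inv enc n \<in> S" and ?B = "\<lambda>n. inv enc n \<in> S'"
  have "semirec ?A" "semirec ?B"
    using assms unfolding m_optimal_def enumerable_iff_semirec by blast+
  note semirec = this
  obtain F where F: "linear_reduction F ?A ?B" "inj F" "\<And>x. x < F x"
    using increasing_reduction[OF semirec(1) m_optimal_linear_reduction[OF assms(2)]] by auto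
  obtain G where G: "linear_reduction G ?B ?A" "inj G" "\<And>x. x < G x"
    using increasing_reduction[OF semirec(2) m_optimal_linear_reduction[OF assms(1)]] by auto
  obtain H where H: "bij H" "linear_reduction H ?A ?B" "linear_bounded (inv H)"
    using increasing_cantor_bernstein[OF F G] by auto
  \<comment> \<open>Conjugation by \<open>enc\<close> commutes with inversion, so
    \<open>nat_conj\<close> returns \<open>H\<close> and \<open>inv H\<close>.\<close>
  define h where "h = inv enc \<circ> H \<circ> enc"
  have bij: "bij h"
    unfolding h_def by (rule bij_comp[OF bij_enc bij_comp[OF H(1) bij_imp_bij_inv[OF bij_enc]], unfolded o_assoc])
  have H_inv: "H (inv H n) = n" "inv H (H n) = n" for n
    using H(1) by (simp_all add: bij_is_surj surj_f_inv_f bij_is_inj)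
  have inv_h: "inv h = inv enc \<circ> inv H \<circ> enc"
    by (rule inv_unique_comp) (simp_all add: h_def fun_eq_iff H_inv)
  have conj_h: "nat_conj h = H"
    by (rule ext) (simp add: nat_conj_def h_def)
  have conj_inv_h: "nat_conj (inv h) = inv H"
    unfolding inv_h by (rule ext) (simp add: nat_conj_def)
  have "computable h" and "length_bounded h" and "length_bounded (inv h)"
    using H(2,3) unfolding linear_reduction_def computable_iff_recursive
      length_bounded_iff_linear_bounded conj_h conj_inv_h by blast+
  moreover have "x \<in> S \<longleftrightarrow> h x \<in> S'" for x
  proof -
    have "?A (enc x) \<longleftrightarrow> ?B (H (enc x))" using H(2) unfolding linear_reduction_def by blast
    then show ?thesis by (simp add: h_def)
  qed
  ultimately show ?thesis using bij by blast
qed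

end
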